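(* Let $n, m, k$ be integers with $n, k \ge 3$ and $m \ge 2$, and let $G = LSG(n,m,k)$ be the layer Sun graph. Then the minimum cardinality of a doubly resolving set of the line graph $L(G)$ is $nm^{k-2} - nm^{k-3}$.
   Context: All graphs are finite, simple and connected; $d(x,y)$ denotes the length of a shortest path between vertices $x$ and $y$ in the graph under consideration. Layer Sun graph: for integers $n,k\ge 3$ and $m\ge 2$, the graph $LSG(n,m,k)$ has vertex set partitioned into layers $V_1\cup V_2\cup\dots\cup V_k$. The layer $V_1=\{1,2,\dots,n\}$ induces the cycle $C_n$. The layer $V_2=\{v_1,\dots,v_n\}$ has $n$ vertices, and each cycle vertex $i$ is adjacent to exactly one vertex of $V_2$, namely $v_i$. For $3\le l\le k$, the layer $V_l$ has $nm^{l-2}$ vertices and is partitioned into $nm^{l-3}$ sets (components) $B^{(l)}_{ij}$, $1\le i\le n$, $1\le j\le m^{l-3}$, each consisting of $m$ pairwise non-adjacent vertices. Each $v_i\in V_2$ is adjacent to all $m$ vertices of $B^{(3)}_{i1}$, and, for $3\le l\le k-1$ and each $i$, the $m^{l-2}$ vertices of $\bigcup_j B^{(l)}_{ij}$ are in bijection with the $m^{l-2}$ components $B^{(l+1)}_{i1},\dots,B^{(l+1)}_{i\,m^{l-2}}$ of $V_{l+1}$, each vertex being adjacent to all $m$ vertices of its corresponding component. There are no other edges. Equivalently, $LSG(n,m,k)$ is obtained from $C_n$ by attaching to each cycle vertex $i$, by an edge to its root $v_i$, a rooted tree in which the root has level $2$, every vertex of level $2,\dots,k-1$ has exactly $m$ children,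 and the vertices of level $k$ are leaves. The graph has order $2n+\sum_{r=1}^{k-2} nm^r$. Line graph: $L(G)$ has vertex set $E(G)$, two distinct edges of $G$ being adjacent in $L(G)$ if and only if they share an endpoint in $G$. Doubly resolving sets: vertices $x,y$ of a graph $H$ doubly resolve vertices $u,v$ of $H$ if $d(u,x)-d(u,y)\ne d(v,x)-d(v,y)$. A set $S$ of vertices of $H$ is a doubly resolving set of $H$ if every two distinct vertices of $H$ are doubly resolved by some two vertices of $S$. *)

theory Defs
  imports Main
begin

type_synonym 'a graph = "'a set \<times> 'a set set"

abbreviation verts :: "'a graph \<Rightarrow> 'a set" where "verts \<equiv> fst"
abbreviation edges :: "'a graph \<Rightarrow> 'a set set" where "edges \<equiv> snd"

definition simple_graph :: "'a graph \<Rightarrow> bool" where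
  "simple_graph G \<longleftrightarrow>
     finite (verts G) \<and> (\<forall>e\<in>edges G. \<exists>u\<in>verts G. \<exists>v\<in>verts G. u \<noteq> v \<and> e = {u, v})"

definition is_path :: "'a graph \<Rightarrow> 'a list \<Rightarrow> bool" where
  "is_path G p \<longleftrightarrow> p \<noteq> [] \<and> distinct p \<and> set p \<subseteq> verts G \<and>
     (\<forall>i. Suc i < length p \<longrightarrow> {p ! i, p ! Suc i} \<in> edges G)"

text \<open>The distance is a meaningful value only if some path joins \<^term>\<open>u\<close> and \<^term>\<open>v\<close>.\<close>

definition gdist :: "'a graph \<Rightarrow> 'a \<Rightarrow> 'a \<Rightarrow> nat" where
  "gdist G u v =
     (LEAST d. \<exists>p. is_path G p \<and> hd p = u \<and> last p = v \<and> length p = Suc d)"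

definition line_graph :: "'a graph \<Rightarrow> 'a set graph" where
  "line_graph G =
     (edges G, {{e, f} |e f. e \<in> edges G \<and> f \<in> edges G \<and> e \<noteq> f \<and> e \<inter> f \<noteq> {}})"

definition doubly_resolve :: "'a graph \<Rightarrow> 'a \<Rightarrow> 'a \<Rightarrow> 'a \<Rightarrow> 'a \<Rightarrow> bool" where
  "doubly_resolve H x y u v \<longleftrightarrow>
     int (gdist H u x) - int (gdist H u y) \<noteq> int (gdist H v x) - int (gdist H v y)"

definition doubly_resolving_set :: "'a graph \<Rightarrow> 'a set \<Rightarrow> bool" where
  "doubly_resolving_set H S \<longleftrightarrow> S \<subseteq> verts H \<and>
     (\<forall>u\<in>verts H. \<forall>v\<in>verts H. u \<noteq> v \<longrightarrow> (\<exists>x\<in>S. \<exists>y\<in>S. doubly_resolve H x y u v))"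

text \<open>
  A vertex of the layer Sun graph is a triple \<open>(l, i, q)\<close>: layer \<open>l\<close> (counted from 1), branch
  \<open>i < n\<close>, and position \<open>q\<close> inside the part of layer \<open>l\<close> lying in branch \<open>i\<close>; branches and
  positions are counted from 0. So \<open>(1, i, 0)\<close> is the cycle vertex of branch \<open>i\<close>, \<open>(2, i, 0)\<close> is
  \<open>v\<^sub>i\<close>, and layer \<open>l \<ge> 2\<close> has \<open>m ^ (l - 2)\<close> vertices in each branch. (For \<open>l = 1\<close> truncated
  subtraction gives \<open>m ^ 0 = 1\<close>, as it should.)
\<close>

type_synonym lsg_vertex = "nat \<times> nat \<times> nat"

definition lsg_layer :: "nat \<Rightarrow> nat \<Rightarrow> nat \<Rightarrow> lsg_vertex set" where
  "lsg_layer n m l = {(l, i, q) |i q. i < n \<and> q < m ^ (l - 2)}"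

text \<open>The \<open>j\<close>-th component of branch \<open>i\<close> in layer \<open>l \<ge> 3\<close>, where \<open>j < m ^ (l - 3)\<close>: a block of
  \<open>m\<close> consecutive positions.\<close>

definition lsg_component :: "nat \<Rightarrow> nat \<Rightarrow> nat \<Rightarrow> nat \<Rightarrow> lsg_vertex set" where
  "lsg_component m l i j = {(l, i, j * m + r) |r. r < m}"

text \<open>The bijection between the vertices of layer \<open>l\<close> and the components of layer \<open>l + 1\<close> in the
  same branch is the identity on positions.\<close>

definition LSG :: "nat \<Rightarrow> nat \<Rightarrow> nat \<Rightarrow> lsg_vertex graph" where
  "LSG n m k =
     (\<Union>l\<in>{1..k}. lsg_layer n m l,
      {{(1, i, 0), (1, (i + 1) mod n, 0)} |i. i < n}
      \<union> {{(1, i, 0), (2, i, 0)} |i. i < n}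
      \<union> {{(l, i, q), w} |l i q w.
            2 \<le> l \<and> l < k \<and> (l, i, q) \<in> lsg_layer n m l \<and> w \<in> lsg_component m (l + 1) i q})"

lemma lsg_component_subset_layer:
  assumes "l \<ge> 3" "i < n" "j < m ^ (l - 3)"
  shows "lsg_component m l i j \<subseteq> lsg_layer n m l"
proof -
  have "l - 2 = Suc (l - 3)" using assms(1) by arith
  then have eq: "m ^ (l - 2) = m ^ (l - 3) * m"
    by (simp add: mult.commute)
  have "j * m + r < m ^ (l - 2)" if "r < m" for r
  proof -
    have "j * m + r < Suc j * m" using that by simp
    also have "\<dots> \<le> m ^ (l - 3) * m" using assms(3) by (intro mult_right_mono) auto
    finally show ?thesis using eq by simp
  qed
  then show ?thesis using assms(2) by (auto simp: lsg_component_def lsg_layer_def)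
qed

lemma lsg_layer_eq_components:
  assumes "l \<ge> 3" "m > 0"
  shows "lsg_layer n m l = (\<Union>i<n. \<Union>j<m ^ (l - 3). lsg_component m l i j)"
proof
  show "(\<Union>i<n. \<Union>j<m ^ (l - 3). lsg_component m l i j) \<subseteq> lsg_layer n m l"
    using lsg_component_subset_layer[OF assms(1)] by blast
  show "lsg_layer n m l \<subseteq> (\<Union>i<n. \<Union>j<m ^ (l - 3). lsg_component m l i j)"
  proof
    fix x assume "x \<in> lsg_layer n m l"
    then obtain i q where x: "x = (l, i, q)" "i < n" "q < m ^ (l - 2)"
      by (auto simp: lsg_layer_def)
    have "l - 2 = Suc (l - 3)" using assms(1) by arith
    then have "m ^ (l - 2) = m ^ (l - 3) * m"
      by (simp add: mult.commute)
    then have "q div m < m ^ (l - 3)" using x(3) by (simp add: less_mult_imp_div_less)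
    moreover have "x \<in> lsg_component m l i (q div m)"
      unfolding lsg_component_def x(1) using assms(2)
      by (auto intro!: exI[of _ "q mod m"])
    ultimately show "x \<in> (\<Union>i<n. \<Union>j<m ^ (l - 3). lsg_component m l i j)"
      using x(2) by auto
  qed
qed

lemma lsg_layer_eq_image:
  "lsg_layer n m l = (\<lambda>(i, q). (l, i, q)) ` ({..<n} \<times> {..<m ^ (l - 2)})"
  by (auto simp: lsg_layer_def)

lemma finite_lsg_layer: "finite (lsg_layer n m l)"
  by (simp add: lsg_layer_eq_image)

lemma card_lsg_layer: "card (lsg_layer n m l) = n * m ^ (l - 2)"
  by (simp add: lsg_layer_eq_image card_image inj_on_def card_cartesian_product)

lemma simple_graph_LSG:
  assumes "n \<ge> 3" "k \<ge> 3"
  shows "simple_graph (LSG n m k)"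
proof -
  let ?V = "verts (LSG n m k)"
  have V: "(l, i, q) \<in> ?V" if "1 \<le> l" "l \<le> k" "i < n" "q < m ^ (l - 2)" for l i q
    using that by (auto simp: LSG_def lsg_layer_def)
  have V1: "(1, i, 0) \<in> ?V" "(2, i, 0) \<in> ?V" if "i < n" for i
    using V[of 1 i 0] V[of 2 i 0] that assms(2) by auto
  have cyc: "i \<noteq> (i + 1) mod n" "(i + 1) mod n < n" if "i < n" for i
    using that assms(1) by (auto simp: mod_Suc)
  have tree: "w \<in> ?V" "fst w = l + 1"
    if "2 \<le> l" "l < k" "(l, i, q) \<in> lsg_layer n m l" "w \<in> lsg_component m (l + 1) i q" for l i q w
  proof -
    have "w \<in> lsg_layer n m (l + 1)"
      using lsg_component_subset_layer[of "l + 1" i n q m] that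
      by (auto simp: lsg_layer_def numeral_3_eq_3 numeral_2_eq_2)
    then show "w \<in> ?V" using that by (auto simp: LSG_def intro!: bexI[of _ "l + 1"])
    show "fst w = l + 1" using that(4) by (auto simp: lsg_component_def)
  qed
  have "\<exists>u\<in>?V. \<exists>v\<in>?V. u \<noteq> v \<and> e = {u, v}" if "e \<in> edges (LSG n m k)" for e
  proof -
    from that consider
        i where "i < n" "e = {(1, i, 0), (1, (i + 1) mod n, 0)}"
      | i where "i < n" "e = {(1, i, 0), (2, i, 0)}"
      | l i q w where "2 \<le> l" "l < k" "(l, i, q) \<in> lsg_layer n m l"
          "w \<in> lsg_component m (l + 1) i q" "e = {(l, i, q), w}"
      unfolding LSG_def by auto
    then show ?thesis
    proof cases
      case (1 i)
      have "(1, i, 0) \<noteq> (1::nat, (i + 1) mod n, 0::nat)"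
        using cyc(1)[OF 1(1)] by (simp del: One_nat_def)
      then show ?thesis unfolding 1(2)
        by (intro bexI[OF _ V1(1)[OF 1(1)]] bexI[OF _ V1(1)[OF cyc(2)[OF 1(1)]]] conjI refl)
    next
      case (2 i)
      have "(1, i, 0) \<noteq> (2::nat, i, 0::nat)" by simp
      then show ?thesis unfolding 2(2)
        by (intro bexI[OF _ V1(1)[OF 2(1)]] bexI[OF _ V1(2)[OF 2(1)]] conjI refl)
    next
      case (3 l i q w)
      have "(l, i, q) \<in> ?V" using 3 V by (auto simp: lsg_layer_def)
      moreover have "(l, i, q) \<noteq> w" using tree(2)[OF 3(1-4)] by auto
      ultimately show ?thesis unfolding 3(5)
        by (intro bexI[of _ "(l, i, q)"] bexI[OF _ tree(1)[OF 3(1-4)]] conjI refl)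
    qed
  qed
  moreover have "finite ?V" by (simp add: LSG_def finite_lsg_layer)
  ultimately show ?thesis by (simp add: simple_graph_def)
qed

lemma card_verts_LSG:
  assumes "k \<ge> 3"
  shows "card (verts (LSG n m k)) = 2 * n + (\<Sum>r=1..k - 2. n * m ^ r)"
proof -
  define d where "d = k - 2"
  have d: "k = d + 2" using assms by (simp add: d_def)
  have "card (verts (LSG n m k)) = (\<Sum>l\<in>{1..k}. card (lsg_layer n m l))"
    unfolding LSG_def fst_conv
    by (rule card_UN_disjoint) (simp_all add: finite_lsg_layer, auto simp: lsg_layer_def)
  also have "\<dots> = (\<Sum>l\<in>{1..d + 2}. n * m ^ (l - 2))" by (simp add: card_lsg_layer d)
  also have "\<dots> = 2 * n + (\<Sum>r=1..d. n * m ^ r)"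
    by (induction d) (auto simp: numeral_2_eq_2)
  finally show ?thesis by (simp add: d)
qed

end

theory Submission imports Defs
begin

text \<open>
  \<^bold>\<open>Lower bound.\<close> Two leaves with the same parent give edges that are adjacent and have the same
  neighbours otherwise (closed twins in the line graph), so no third edge distinguishes their
  distances. A doubly resolving set therefore omits at most one of the \<open>m\<close> leaf edges of each of the
  \<open>n m\<^bsup>k-3\<^esup>\<close> components of the last layer (\<open>one_missing\<close>, \<open>lower_bound\<close>).

  \<^bold>\<open>Upper bound.\<close> Omitting exactly one leaf edge of each component leaves a set that doubly resolves.
  Give a cycle edge level 1 and an edge towards a vertex of layer \<open>l\<close> level \<open>l\<close>. The level changes by at
  most one between adjacent edges, so an edge of level \<open>l\<close> is at distance at least \<open>k - l\<close> from every
  leaf edge, and a walk attaining this bound must descend one level at every step. Thus equality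
  holds exactly for the leaf edges below it, where a cycle edge counts as being above both
  branches that it touches. Moreover a walk out of a branch first climbs to level 1 and then
  descends again, so a tree edge of level \<open>l\<close> is at distance at least \<open>k + l - 2\<close> from the leaf edges of
  other branches, with equality for the next branch. These four facts suffice:

  \<^item> Two cycle edges differ in the pair of branches at the minimal distance \<open>k - 1\<close>.
  \<^item> A tree edge is nearer than \<open>k\<close> to some chosen leaf edge of its own branch, and at distance at
    least \<open>k\<close> from all other branches. No cycle edge prefers a single branch in this way, and two
    tree edges of different branches prefer different ones.
  \<^item> For two tree edges of the same branch, of levels \<open>l \<le> l'\<close>, a leaf edge of the next branch shows
    that the difference of their distances could only be the constant \<open>l' - l\<close>. A chosen leaf edge
    below the deeper one, or next to it when it is itself a leaf edge that was omitted, refutes this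
    (\<open>resolved_same_branch\<close>).

  Distances are bounded instead of computed: lower bounds come from integer potentials that drop by at most one along an adjacency (\<open>potential_le_ldist\<close>), upper bounds from
  explicit walks; both work for walks as well as for paths, so the distance is first rewritten as a
  least exponent of the adjacency relation.
\<close>

section \<open>Distance as least walk length\<close>

definition adj :: "'a graph \<Rightarrow> 'a rel" where
  "adj H = {(u, v). {u, v} \<in> edges H}"

lemma adj_sym: "(u, v) \<in> adj H \<Longrightarrow> (v, u) \<in> adj H"
  by (simp add: adj_def insert_commute)

lemma walk_sym: "(u, v) \<in> adj H ^^ d \<Longrightarrow> (v, u) \<in> adj H ^^ d"
proof (induction d arbitrary: u)
  case (Suc d)
  then obtain w where "(u, w) \<in> adj H" "(w, v) \<in> adj H ^^ d"
    by (meson relpow_Suc_D2)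
  then show ?case
    using Suc.IH adj_sym by (metis relpow_Suc_I)
qed auto

lemma path_imp_walk:
  "is_path H p \<Longrightarrow> (hd p, last p) \<in> adj H ^^ (length p - 1)"
proof (induction p rule: induct_list012)
  case (3 a b p)
  have "{a, b} \<in> edges H" using 3(3) by (force simp: is_path_def)
  moreover have "is_path H (b # p)" using 3(3) by (force simp: is_path_def)
  ultimately show ?case
    using 3(2) by (auto simp: adj_def intro: relpow_Suc_I2 simp del: relpow.simps)
qed (auto simp: is_path_def)

lemma is_path_Cons:
  "is_path H p \<Longrightarrow> u \<notin> set p \<Longrightarrow> u \<in> verts H \<Longrightarrow> {u, hd p} \<in> edges H \<Longrightarrow> is_path H (u # p)"
  unfolding is_path_def by (auto simp: nth_Cons hd_conv_nth split: nat.split)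

lemma is_path_suffix: "is_path H (xs @ ys) \<Longrightarrow> ys \<noteq> [] \<Longrightarrow> is_path H ys"
  unfolding is_path_def
proof (elim conjE, intro conjI allI impI)
  fix i assume *: "\<forall>i. Suc i < length (xs @ ys) \<longrightarrow> {(xs @ ys) ! i, (xs @ ys) ! Suc i} \<in> edges H"
    and "Suc i < length ys"
  then show "{ys ! i, ys ! Suc i} \<in> edges H"
    using *[rule_format, of "length xs + i"] by (simp add: nth_append)
qed auto

text \<open>A walk becomes a path by cutting out, whenever a vertex is prepended that already occurs,
  everything before that occurrence; this only shortens it.\<close>

lemma walk_imp_path:
  assumes E: "\<And>e. e \<in> edges H \<Longrightarrow> e \<subseteq> verts H" and v: "v \<in> verts H"
  shows "(u, v) \<in> adj H ^^ d \<Longrightarrow> \<exists>p. is_path H p \<and> hd p = u \<and> last p = v \<and> length p \<le> Suc d"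
proof (induction d arbitrary: u)
  case 0
  then show ?case using v by (intro exI[of _ "[v]"]) (auto simp: is_path_def)
next
  case (Suc d)
  then obtain w where w: "(u, w) \<in> adj H" "(w, v) \<in> adj H ^^ d"
    by (meson relpow_Suc_D2)
  from Suc.IH[OF w(2)] obtain p where p: "is_path H p" "hd p = w" "last p = v" "length p \<le> Suc d"
    by auto
  have ne: "p \<noteq> []" using p(1) by (simp add: is_path_def)
  show ?case
  proof (cases "u \<in> set p")
    case False
    have uw: "{u, w} \<in> edges H" using w(1) by (simp add: adj_def)
    then have "u \<in> verts H" using E by blast
    then have "is_path H (u # p)" using is_path_Cons[OF p(1) False] uw p(2) by simp
    then show ?thesis using p ne by (intro exI[of _ "u # p"]) auto
  next
    case True
    then obtain xs ys where xy: "p = xs @ u # ys" by (meson split_list)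
    then have "is_path H (u # ys)" using is_path_suffix p(1) by blast
    then show ?thesis using p xy by (intro exI[of _ "u # ys"]) auto
  qed
qed

lemma Least_eq_if_cofinal:
  fixes P Q :: "nat \<Rightarrow> bool"
  assumes "\<And>d. P d \<Longrightarrow> Q d" and "\<And>d. Q d \<Longrightarrow> \<exists>d'\<le>d. P d'"
  shows "(LEAST d. P d) = (LEAST d. Q d)"
proof (cases "\<exists>d. Q d")
  case True
  then have Q: "Q (LEAST d. Q d)" by (blast intro: LeastI_ex)
  have P: "P (LEAST d. P d)" using True assms(2) by (blast intro: LeastI_ex)
  have "(LEAST d. Q d) \<le> (LEAST d. P d)" using assms(1)[OF P] by (rule Least_le)
  moreover obtain d' where "d' \<le> (LEAST d. Q d)" "P d'" using assms(2)[OF Q] by blast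
  then have "(LEAST d. P d) \<le> (LEAST d. Q d)" by (meson Least_le order_trans)
  ultimately show ?thesis by simp
next
  case False
  then have "P = Q" using assms(1) by blast
  then show ?thesis by simp
qed

text \<open>If no walk exists, both minima range over the empty predicate and agree as well.\<close>

lemma gdist_eq_Least_walk:
  assumes "\<And>e. e \<in> edges H \<Longrightarrow> e \<subseteq> verts H" and "v \<in> verts H"
  shows "gdist H u v = (LEAST d. (u, v) \<in> adj H ^^ d)"
  unfolding gdist_def
proof (rule Least_eq_if_cofinal)
  fix d assume "\<exists>p. is_path H p \<and> hd p = u \<and> last p = v \<and> length p = Suc d"
  then obtain p where "is_path H p" "hd p = u" "last p = v" "length p = Suc d" by blast
  then show "(u, v) \<in> adj H ^^ d" using path_imp_walk[of H p] by simp
next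
  fix d assume "(u, v) \<in> adj H ^^ d"
  from walk_imp_path[OF assms this]
  obtain p where p: "is_path H p" "hd p = u" "last p = v" "length p \<le> Suc d" by blast
  moreover have "length p = Suc (length p - 1)"
    using p(1) by (cases p) (auto simp: is_path_def)
  ultimately show "\<exists>d'\<le>d. \<exists>p. is_path H p \<and> hd p = u \<and> last p = v \<and> length p = Suc d'"
    by (intro exI[of _ "length p - 1"] conjI exI[of _ p]) auto
qed

text \<open>The first step of a walk from \<open>u\<close> either enters its twin \<open>v\<close>, and can be dropped, or can be made
  from \<open>v\<close> instead.\<close>

lemma twin_walk:
  assumes "(u, x) \<in> adj H ^^ d" "x \<noteq> u"
    and "\<And>w. (u, w) \<in> adj H \<Longrightarrow> w = v \<or> (v, w) \<in> adj H"
  shows "\<exists>d'\<le>d. (v, x) \<in> adj H ^^ d'"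
proof (cases d)
  case 0
  then show ?thesis using assms(1,2) by simp
next
  case (Suc c)
  then obtain w where w: "(u, w) \<in> adj H" "(w, x) \<in> adj H ^^ c"
    using assms(1) by (metis relpow_Suc_D2)
  from assms(3)[OF w(1)] show ?thesis
  proof
    assume "w = v"
    then show ?thesis using w(2) Suc by (intro exI[of _ c]) auto
  next
    assume "(v, w) \<in> adj H"
    then show ?thesis using relpow_Suc_I2[OF _ w(2)] Suc by blast
  qed
qed

section \<open>The edges of the layer Sun graph\<close>

text \<open>The graph is unicyclic, so it has as many edges as vertices, and a vertex serves as a name for
  an edge: a vertex outside the cycle names the edge towards the cycle, and a cycle vertex names
  the cycle edge to its successor. In layer 2 the position is 0, and \<open>0 div m = 0\<close> is the position of
  the cycle vertex, so all non-cycle edges have the same form.\<close>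

definition edge_of :: "nat \<Rightarrow> nat \<Rightarrow> lsg_vertex \<Rightarrow> lsg_vertex set" where
  "edge_of n m = (\<lambda>(l, i, q). if l = 1 then {(1, i, 0), (1, (i + 1) mod n, 0)}
     else {(l - 1, i, q div m), (l, i, q)})"

locale layer_sun =
  fixes n m k :: nat
  assumes n3: "n \<ge> 3" and k3: "k \<ge> 3" and m2: "m \<ge> 2"
begin

abbreviation "V \<equiv> verts (LSG n m k)"
abbreviation "L \<equiv> line_graph (LSG n m k)"
abbreviation "edge \<equiv> edge_of n m"

definition ldist :: "lsg_vertex \<Rightarrow> lsg_vertex \<Rightarrow> nat" where
  "ldist a b = gdist L (edge a) (edge b)"

lemma V_iff: "(l, i, q) \<in> V \<longleftrightarrow> 1 \<le> l \<and> l \<le> k \<and> i < n \<and> q < m ^ (l - 2)"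
  by (auto simp: LSG_def lsg_layer_def)

lemma div_less_layer:
  assumes "q < m ^ (l - 2)" "2 \<le> l"
  shows "q div m < m ^ (l - 1 - 2)"
proof (cases "l = 2")
  case False
  then have "l - 2 = Suc (l - 1 - 2)" using assms(2) by simp
  then show ?thesis using assms(1) by (simp add: less_mult_imp_div_less mult.commute)
qed (use assms in auto)

lemma V_parent: "(l, i, q) \<in> V \<Longrightarrow> 2 \<le> l \<Longrightarrow> (l - 1, i, q div m) \<in> V"
  using div_less_layer by (auto simp: V_iff)

lemma edge_of_simps:
  "edge (Suc 0, i, q) = {(1, i, 0), (1, (i + 1) mod n, 0)}"
  "2 \<le> l \<Longrightarrow> edge (l, i, q) = {(l - 1, i, q div m), (l, i, q)}"
  by (auto simp: edge_of_def)

lemma edges_LSG: "edges (LSG n m k) = edge ` V"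
proof
  show "edges (LSG n m k) \<subseteq> edge ` V"
  proof
    fix e assume "e \<in> edges (LSG n m k)"
    then consider
        i where "i < n" "e = {(1, i, 0), (1, (i + 1) mod n, 0)}"
      | i where "i < n" "e = {(1, i, 0), (2, i, 0)}"
      | l i q w where "2 \<le> l" "l < k" "(l, i, q) \<in> lsg_layer n m l"
          "w \<in> lsg_component m (l + 1) i q" "e = {(l, i, q), w}"
      unfolding LSG_def by auto
    then show "e \<in> edge ` V"
    proof cases
      case (1 i)
      then have "(1, i, 0) \<in> V" "e = edge (1, i, 0)" using k3 by (simp_all add: V_iff edge_of_simps)
      then show ?thesis by blast
    next
      case (2 i)
      then have "(2, i, 0) \<in> V" "e = edge (2, i, 0)" using k3 by (simp_all add: V_iff edge_of_simps)
      then show ?thesis by blast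
    next
      case (3 l i q w)
      have "w \<in> lsg_layer n m (l + 1)"
        using lsg_component_subset_layer[of "l + 1" i n q m] 3(1,3,4)
        by (auto simp: lsg_layer_def numeral_3_eq_3 numeral_2_eq_2)
      moreover obtain r where r: "r < m" "w = (l + 1, i, q * m + r)"
        using 3(4) by (auto simp: lsg_component_def)
      ultimately have "w \<in> V" using 3(2) by (simp add: V_iff lsg_layer_def)
      moreover have "e = edge w" using r 3(1,5) by (simp add: edge_of_simps)
      ultimately show ?thesis by blast
    qed
  qed
  show "edge ` V \<subseteq> edges (LSG n m k)"
  proof
    fix e assume "e \<in> edge ` V"
    then obtain l i q where a: "(l, i, q) \<in> V" "e = edge (l, i, q)" by auto
    have i: "i < n" using a by (simp add: V_iff)
    consider "l = 1" | "l = 2" "q = 0" | "l \<ge> 3" using a(1) by (fastforce simp: V_iff)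
    then show "e \<in> edges (LSG n m k)"
    proof cases
      case 1
      then have "e = {(1, i, 0), (1, (i + 1) mod n, 0)}" using a by (simp add: edge_of_simps)
      then show ?thesis unfolding LSG_def snd_conv using i by blast
    next
      case 2
      then have "e = {(1, i, 0), (2, i, 0)}" using a by (simp add: edge_of_simps)
      then show ?thesis unfolding LSG_def snd_conv using i by blast
    next
      case 3
      have "e = {(l - 1, i, q div m), (l, i, q)}" using a 3 by (simp add: edge_of_simps)
      moreover have "(l - 1, i, q div m) \<in> lsg_layer n m (l - 1)"
        using V_parent[OF a(1)] 3 by (simp add: V_iff lsg_layer_def)
      moreover have "(l, i, q) \<in> lsg_component m (l - 1 + 1) i (q div m)"
      proof -
        have "q = q div m * m + q mod m" "q mod m < m" using m2 by simp_all
        then show ?thesis using 3 unfolding lsg_component_def by fastforce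
      qed
      moreover have "2 \<le> l - 1" "l - 1 < k" using 3 a(1) by (auto simp: V_iff)
      ultimately show ?thesis unfolding LSG_def snd_conv by blast
    qed
  qed
qed

lemma mod_succ_ne: "i < n \<Longrightarrow> (i + 1) mod n \<noteq> i"
  using n3 by (auto simp: mod_Suc)

lemma mod_succ_succ_ne: "i < n \<Longrightarrow> ((i + 1) mod n + 1) mod n \<noteq> i"
  using n3 by (auto simp: mod_Suc split: if_splits)

text \<open>Distinct cycle vertices name distinct cycle edges because a cycle of length at least 3 has no
  \<open>i\<close> with \<open>i + 2 = i\<close> modulo \<open>n\<close>.\<close>

lemma inj_edge_of: "inj_on edge V"
proof (rule inj_onI, clarsimp simp: V_iff)
  fix l i q l' i' q'
  assume *: "Suc 0 \<le> l" "l \<le> k" "i < n" "q < m ^ (l - 2)"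
    "Suc 0 \<le> l'" "l' \<le> k" "i' < n" "q' < m ^ (l' - 2)"
    and eq: "edge (l, i, q) = edge (l', i', q')"
  consider "l = 1" "l' = 1" | "l = 1" "l' \<ge> 2" | "l' = 1" "l \<ge> 2" | "l \<ge> 2" "l' \<ge> 2"
    using *(1,5) by linarith
  then show "l = l' \<and> i = i' \<and> q = q'"
  proof cases
    case 1
    then show ?thesis using eq * mod_succ_succ_ne[of i]
      by (auto simp: edge_of_def doubleton_eq_iff)
  qed (use eq * in \<open>auto simp: edge_of_def doubleton_eq_iff\<close>)
qed

lemma verts_L: "verts L = edge ` V"
  by (simp add: line_graph_def edges_LSG)

lemma edges_L_subset: "e \<in> edges L \<Longrightarrow> e \<subseteq> verts L"
  by (auto simp: line_graph_def)

lemma adj_iff: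
  assumes "a \<in> V" "b \<in> V"
  shows "(edge a, edge b) \<in> adj L \<longleftrightarrow> a \<noteq> b \<and> edge a \<inter> edge b \<noteq> {}"
proof -
  have "edge a = edge b \<longleftrightarrow> a = b" using inj_edge_of assms by (auto dest: inj_onD)
  then show ?thesis using assms
    by (auto simp: adj_def line_graph_def edges_LSG doubleton_eq_iff)
qed

lemma adjE:
  assumes "(edge a, e) \<in> adj L" "a \<in> V"
  obtains b where "b \<in> V" "e = edge b" "a \<noteq> b" "edge a \<inter> edge b \<noteq> {}"
proof -
  have "e \<in> verts L" using assms(1) edges_L_subset[of "{edge a, e}"] by (simp add: adj_def)
  then obtain b where "b \<in> V" "e = edge b" by (auto simp: verts_L)
  then show thesis using that assms adj_iff by blast
qed

lemma adj_up: "(l, i, q) \<in> V \<Longrightarrow> 3 \<le> l \<Longrightarrow> (edge (l - 1, i, q div m), edge (l, i, q)) \<in> adj L"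
  using V_parent[of l i q] by (auto simp: adj_iff) (auto simp: edge_of_def)

lemma adj_cycle_root:
  assumes "i < n" "p \<in> {i, (i + 1) mod n}"
  shows "(edge (1, i, 0), edge (2, p, 0)) \<in> adj L"
proof -
  have "(1, i, 0) \<in> V" "(2, p, 0) \<in> V" using assms k3 by (auto simp: V_iff)
  then show ?thesis using assms by (auto simp: adj_iff) (auto simp: edge_of_def)
qed

lemma adj_cycle_succ:
  assumes "Suc i < n"
  shows "(edge (1, i, 0), edge (1, Suc i, 0)) \<in> adj L"
proof -
  have "(1, i, 0) \<in> V" "(1, Suc i, 0) \<in> V" using assms k3 by (auto simp: V_iff)
  then show ?thesis using assms by (auto simp: adj_iff) (auto simp: edge_of_def)
qed

lemma adjacent_cases:
  assumes "(l, i, q) \<in> V" "(l', i', q') \<in> V"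
    and "edge (l, i, q) \<inter> edge (l', i', q') \<noteq> {}"
  obtains (cycle) "l = 1" "l' = 1"
    | (siblings) "2 \<le> l" "l' = l" "i' = i" "q' div m = q div m"
    | (child) "2 \<le> l" "l' = l + 1" "i' = i" "q' div m = q"
    | (parent) "2 \<le> l'" "l = l' + 1" "i' = i" "q div m = q'"
    | (spoke_out) "l = 1" "l' = 2" "i' \<in> {i, (i + 1) mod n}"
    | (spoke_in) "l' = 1" "l = 2" "i \<in> {i', (i' + 1) mod n}"
proof -
  consider "l = 1" "l' = 1" | "l = 1" "l' \<ge> 2" | "l' = 1" "l \<ge> 2" | "l \<ge> 2" "l' \<ge> 2"
    using assms(1,2) by (fastforce simp: V_iff)
  then show thesis
  proof cases
    case 1 then show thesis by (rule cycle)
  next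
    case 2 then show thesis using assms(3) spoke_out by (auto simp: edge_of_def)
  next
    case 3 then show thesis using assms(3) spoke_in by (auto simp: edge_of_def)
  next
    case 4
    then have "l' = l \<and> i' = i \<and> q' div m = q div m \<or> l' = l + 1 \<and> i' = i \<and> q' div m = q
       \<or> l = l' + 1 \<and> i' = i \<and> q div m = q'"
      using assms(3) by (auto simp: edge_of_def)
    with 4 show thesis using siblings child parent by blast
  qed
qed

section \<open>Distances in the line graph\<close>

lemma d_Least: "b \<in> V \<Longrightarrow> ldist a b = (LEAST c. (edge a, edge b) \<in> adj L ^^ c)"
  unfolding ldist_def by (rule gdist_eq_Least_walk[OF edges_L_subset]) (auto simp: verts_L)

lemma ldist_le: "b \<in> V \<Longrightarrow> (edge a, edge b) \<in> adj L ^^ c \<Longrightarrow> ldist a b \<le> c"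
  by (simp add: d_Least Least_le)

text \<open>Dividing the position by \<open>m\<close> moves to the parent, hence \<open>q div m ^ (l - j)\<close> is the ancestor in
  layer \<open>j\<close>.\<close>

lemma walk_down:
  assumes "(l, i, q) \<in> V" "2 \<le> j" "j \<le> l"
  shows "(edge (j, i, q div m ^ (l - j)), edge (l, i, q)) \<in> adj L ^^ (l - j)"
  using assms
proof (induction "l - j" arbitrary: l q)
  case (Suc c)
  then have c: "l - j = Suc (l - 1 - j)" "c = l - 1 - j" "3 \<le> l" by auto
  have "(edge (j, i, q div m div m ^ (l - 1 - j)), edge (l - 1, i, q div m)) \<in> adj L ^^ (l - 1 - j)"
    using c V_parent[OF Suc(3)] Suc by (intro Suc(1)) auto
  then show ?case unfolding c(1) using adj_up[OF Suc(3)] c(3)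
    by (auto simp: div_mult2_eq)
qed auto

lemma walk_root:
  assumes "(l, i, q) \<in> V" "2 \<le> l"
  shows "(edge (2, i, 0), edge (l, i, q)) \<in> adj L ^^ (l - 2)"
  using walk_down[OF assms(1), of 2] assms by (simp add: V_iff)

lemma walk_cycle:
  assumes "(l, p, q) \<in> V" "2 \<le> l" "i < n" "p \<in> {i, (i + 1) mod n}"
  shows "(edge (1, i, 0), edge (l, p, q)) \<in> adj L ^^ (l - 1)"
proof -
  have "(edge (1, i, 0), edge (l, p, q)) \<in> adj L ^^ (Suc (l - 2))"
    using adj_cycle_root[OF assms(3,4)] walk_root[OF assms(1,2)] by (rule relpow_Suc_I2)
  then show ?thesis using assms(2) by (simp add: numeral_2_eq_2 Suc_diff_Suc del: relpow.simps)
qed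

lemma connected:
  assumes "a \<in> V" "b \<in> V"
  obtains c where "(edge a, edge b) \<in> adj L ^^ c"
proof -
  have cyc: "(edge (1, 0, 0), edge (1, i, 0)) \<in> (adj L)\<^sup>*" if "i < n" for i
    using that
  proof (induction i)
    case (Suc i)
    then show ?case using adj_cycle_succ[of i] by (auto intro: rtrancl_into_rtrancl)
  qed auto
  have base: "(edge (1, 0, 0), edge c) \<in> (adj L)\<^sup>*" if c: "c \<in> V" for c
  proof -
    obtain l i q where [simp]: "c = (l, i, q)" by (cases c)
    consider "l = 1" "q = 0" | "2 \<le> l" using c by (fastforce simp: V_iff)
    then show ?thesis
    proof cases
      case 1
      then show ?thesis using cyc c by (auto simp: V_iff)
    next
      case 2
      then have "(edge (1, i, 0), edge c) \<in> (adj L)\<^sup>*"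
        using walk_cycle[of l i q i] c by (auto simp: V_iff intro: relpow_imp_rtrancl)
      then show ?thesis using cyc[of i] c by (auto simp: V_iff)
    qed
  qed
  have "sym ((adj L)\<^sup>*)" by (rule sym_rtrancl) (auto intro!: symI adj_sym)
  then have "(edge a, edge b) \<in> (adj L)\<^sup>*"
    using base[OF assms(1)] base[OF assms(2)] by (meson rtrancl_trans symD)
  then show thesis using that by (auto simp: rtrancl_is_UN_relpow)
qed

lemma walk_ldist:
  assumes "a \<in> V" "b \<in> V"
  shows "(edge a, edge b) \<in> adj L ^^ ldist a b"
  unfolding d_Least[OF assms(2)] by (rule connected[OF assms]) (rule LeastI)

text \<open>The source of all lower bounds on distances: along a walk of length \<open>c\<close> the potential can drop
  by at most \<open>c\<close>.\<close>

lemma potential_le_ldist: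
  fixes h :: "lsg_vertex \<Rightarrow> int"
  assumes "\<And>a b. a \<in> V \<Longrightarrow> b \<in> V \<Longrightarrow> edge a \<inter> edge b \<noteq> {} \<Longrightarrow> h a \<le> h b + 1"
    and "a \<in> V" "b \<in> V"
  shows "h a \<le> h b + int (ldist a b)"
proof -
  have "h a \<le> h b + int c" if "a \<in> V" "(edge a, edge b) \<in> adj L ^^ c" for a c
    using that
  proof (induction c arbitrary: a)
    case 0
    then show ?case using inj_onD[OF inj_edge_of, of a b] assms(3) by simp
  next
    case (Suc c)
    then obtain e where e: "(edge a, e) \<in> adj L" "(e, edge b) \<in> adj L ^^ c"
      by (meson relpow_Suc_D2)
    obtain a' where "a' \<in> V" "e = edge a'" "edge a \<inter> edge a' \<noteq> {}"
      using adjE[OF e(1) Suc.prems(1)] by metis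
    then show ?case using Suc.IH[of a'] assms(1)[OF Suc.prems(1), of a'] e(2) by simp
  qed
  then show ?thesis using walk_ldist assms by blast
qed

text \<open>Whether a descending sequence of edges, one level at a time, leads from the first edge to the
  second; a cycle edge can be left downwards at both of its ends.\<close>

definition above :: "lsg_vertex \<Rightarrow> lsg_vertex \<Rightarrow> bool" where
  "above = (\<lambda>(l, i, q) (l', p, s). if l = 1 then p \<in> {i, (i + 1) mod n}
     else i = p \<and> q = s div m ^ (l' - l))"

text \<open>The potential is the level bound \<open>k - l\<close>, raised by one on the edges that are not above the
  target. It could drop by two only along a step down, away from the cycle, from an edge that is not
  above the target to one that is; but the upper neighbours of an edge above the target are above it
  too.\<close>

lemma ldist_ge_if_not_above:
  assumes a: "(l, i, q) \<in> V" and x: "(k, p, s) \<in> V" and na: "\<not> above (l, i, q) (k, p, s)"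
  shows "k - l + 1 \<le> ldist (l, i, q) (k, p, s)"
proof -
  define h where "h c = int k - int (fst c) + (if above c (k, p, s) then 0 else 1)" for c
  have step: "h a \<le> h b + 1" if "a \<in> V" "b \<in> V" "edge a \<inter> edge b \<noteq> {}" for a b
  proof -
    obtain l i q where [simp]: "a = (l, i, q)" by (cases a)
    obtain l' i' q' where [simp]: "b = (l', i', q')" by (cases b)
    have "above a (k, p, s)" if "above b (k, p, s)" "l < l'"
    proof -
      have l': "1 \<le> l" "l' \<le> k" using \<open>a \<in> V\<close> \<open>b \<in> V\<close> by (auto simp: V_iff)
      from \<open>a \<in> V\<close> \<open>b \<in> V\<close> \<open>edge a \<inter> edge b \<noteq> {}\<close> show ?thesis unfolding \<open>a = _\<close> \<open>b = _\<close>
      proof (cases rule: adjacent_cases)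
        case child
        then have "k - l = Suc (k - l')" using l' by simp
        then have "m ^ (k - l) = m ^ (k - l') * m" by simp
        then show "above (l, i, q) (k, p, s)" using child that
          by (auto simp: above_def div_mult2_eq)
      qed (use that in \<open>auto simp: above_def\<close>)
    qed
    moreover have "l' \<le> l + 1"
      using that unfolding \<open>a = _\<close> \<open>b = _\<close> by (cases rule: adjacent_cases) auto
    ultimately show ?thesis by (cases "l < l'") (simp_all add: h_def)
  qed
  from potential_le_ldist[where h = h, OF step a x]
  have "h (l, i, q) \<le> h (k, p, s) + int (ldist (l, i, q) (k, p, s))" .
  moreover have "h (k, p, s) = 0" using k3 by (simp add: h_def above_def)
  moreover have "h (l, i, q) = int k - int l + 1" using na by (simp add: h_def)
  moreover have "l \<le> k" using a by (simp add: V_iff)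
  ultimately show ?thesis by linarith
qed

lemma ldist_above:
  assumes a: "(l, i, q) \<in> V" and x: "(k, p, s) \<in> V" and "above (l, i, q) (k, p, s)"
  shows "ldist (l, i, q) (k, p, s) \<le> k - l"
proof (rule ldist_le[OF x])
  consider "l = 1" "q = 0" | "2 \<le> l" using a by (fastforce simp: V_iff)
  then show "(edge (l, i, q), edge (k, p, s)) \<in> adj L ^^ (k - l)"
  proof cases
    case 1
    then show ?thesis using walk_cycle[OF x, of i] assms k3 by (auto simp: above_def V_iff)
  next
    case 2
    then show ?thesis using walk_down[OF x, of l] assms by (auto simp: above_def V_iff)
  qed
qed

lemma ldist_ge_level:
  assumes a: "(l, i, q) \<in> V" and x: "(k, p, s) \<in> V"
  shows "k - l \<le> ldist (l, i, q) (k, p, s)"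
proof -
  define h :: "lsg_vertex \<Rightarrow> int" where "h c = - int (fst c)" for c
  have step: "h a \<le> h b + 1" if "a \<in> V" "b \<in> V" "edge a \<inter> edge b \<noteq> {}" for a b
  proof -
    obtain l i q where [simp]: "a = (l, i, q)" by (cases a)
    obtain l' i' q' where [simp]: "b = (l', i', q')" by (cases b)
    show ?thesis using that unfolding \<open>a = _\<close> \<open>b = _\<close>
      by (cases rule: adjacent_cases) (auto simp: h_def)
  qed
  from potential_le_ldist[where h = h, OF step a x] show ?thesis by (simp add: h_def)
qed

text \<open>Inside branch \<open>i\<close> the potential is the cost of climbing to level 1 and descending to level \<open>k\<close>;
  everywhere else it is the cost of descending. The two expressions match at level 1, and the
  branch can only be left through that level.\<close>

lemma ldist_other_branch_ge:
  assumes a: "(l, i, q) \<in> V" "2 \<le> l" and x: "(k, p, s) \<in> V" "p \<noteq> i"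
  shows "k + l - 2 \<le> ldist (l, i, q) (k, p, s)"
proof -
  define h where "h = (\<lambda>(l', i', q' :: nat). if 2 \<le> l' \<and> i' = i then int k + int l' - 2 else int k - int l')"
  have step: "h a \<le> h b + 1" if "a \<in> V" "b \<in> V" "edge a \<inter> edge b \<noteq> {}" for a b
  proof -
    obtain l i q where [simp]: "a = (l, i, q)" by (cases a)
    obtain l' i' q' where [simp]: "b = (l', i', q')" by (cases b)
    show ?thesis using that unfolding \<open>a = _\<close> \<open>b = _\<close>
      by (cases rule: adjacent_cases) (auto simp: h_def)
  qed
  from potential_le_ldist[where h = h, OF step a(1) x(1)] show ?thesis using a x by (auto simp: h_def)
qed

text \<open>The cycle edge named \<open>i\<close> touches both branches, so the bound for other branches is attained.\<close>

lemma ldist_next_branch: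
  assumes a: "(l, i, q) \<in> V" "2 \<le> l" and x: "(k, (i + 1) mod n, s) \<in> V"
  shows "ldist (l, i, q) (k, (i + 1) mod n, s) = k + l - 2"
proof (rule antisym)
  have i: "i < n" using a by (simp add: V_iff)
  have "(edge (l, i, q), edge (1, i, 0)) \<in> adj L ^^ (l - 1)"
    by (rule walk_sym[OF walk_cycle[OF a i]]) simp
  moreover have "(edge (1, i, 0), edge (k, (i + 1) mod n, s)) \<in> adj L ^^ (k - 1)"
    by (rule walk_cycle[OF x _ i]) (use k3 in simp_all)
  ultimately have "(edge (l, i, q), edge (k, (i + 1) mod n, s)) \<in> adj L ^^ (l - 1 + (k - 1))"
    unfolding relpow_add by (rule relcompI)
  then have "ldist (l, i, q) (k, (i + 1) mod n, s) \<le> l - 1 + (k - 1)"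
    by (rule ldist_le[OF x])
  then show "ldist (l, i, q) (k, (i + 1) mod n, s) \<le> k + l - 2" using a k3 by simp
  show "k + l - 2 \<le> ldist (l, i, q) (k, (i + 1) mod n, s)"
    using ldist_other_branch_ge[OF a x] mod_succ_ne[OF i] by simp
qed

lemma ldist_self: "a \<in> V \<Longrightarrow> ldist a a = 0"
  using ldist_le[of a a 0] by simp

lemma ldist_pos:
  assumes "a \<in> V" "b \<in> V" "a \<noteq> b"
  shows "0 < ldist a b"
  using walk_ldist[OF assms(1,2)] inj_onD[OF inj_edge_of _ assms(1,2)] assms(3) by (cases "ldist a b") auto

lemma ldist_sibling_leaves:
  assumes "(k, i, q) \<in> V" "(k, i, q') \<in> V" "q div m = q' div m" "q \<noteq> q'"
  shows "ldist (k, i, q) (k, i, q') = 1"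
proof -
  have "(edge (k, i, q), edge (k, i, q')) \<in> adj L"
    using assms k3 by (auto simp: adj_iff) (auto simp: edge_of_def)
  then have "ldist (k, i, q) (k, i, q') \<le> 1" using ldist_le[OF assms(2), of _ 1] by simp
  moreover have "0 < ldist (k, i, q) (k, i, q')" using ldist_pos[OF assms(1,2)] assms(4) by simp
  ultimately show ?thesis by simp
qed

lemma siblings_if_ldist_1:
  assumes "(k, i, q) \<in> V" "(k, i, q') \<in> V" "ldist (k, i, q) (k, i, q') = 1"
  shows "q div m = q' div m"
proof -
  have "(edge (k, i, q), edge (k, i, q')) \<in> adj L" using walk_ldist[OF assms(1,2)] assms(3) by simp
  then have "edge (k, i, q) \<inter> edge (k, i, q') \<noteq> {}" using assms(1,2) by (simp add: adj_iff)
  with assms(1,2) show ?thesis by (cases rule: adjacent_cases) (use k3 in auto)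
qed

section \<open>Twin leaf edges and the lower bound\<close>

text \<open>A leaf has degree one, so any other edge that meets its edge does so at the common parent.\<close>

lemma sibling_leaves_twins:
  assumes u: "(k, i, q) \<in> V" and v: "(k, i, q') \<in> V" and "q div m = q' div m"
    and w: "(edge (k, i, q), w) \<in> adj L"
  shows "w = edge (k, i, q') \<or> (edge (k, i, q'), w) \<in> adj L"
proof -
  obtain b where b: "b \<in> V" "w = edge b" "edge (k, i, q) \<inter> edge b \<noteq> {}" "b \<noteq> (k, i, q)"
    using adjE[OF w u] by metis
  obtain l' i' s where [simp]: "b = (l', i', s)" by (cases b)
  have "edge b \<inter> edge (k, i, q') \<noteq> {}" if "b \<noteq> (k, i, q')"
    using u b(1,3) unfolding \<open>b = _\<close>
  proof (cases rule: adjacent_cases)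
    case child
    then show "edge (l', i', s) \<inter> edge (k, i, q') \<noteq> {}" using b(1) by (simp add: V_iff)
  qed (use that assms(3) k3 in \<open>auto simp: edge_of_def\<close>)
  then show ?thesis using b v by (auto simp: adj_iff)
qed

lemma twin_ldist_le:
  assumes u: "(k, i, q) \<in> V" and v: "(k, i, q') \<in> V" and q: "q div m = q' div m"
    and x: "x \<in> V" "x \<noteq> (k, i, q)"
  shows "ldist (k, i, q') x \<le> ldist (k, i, q) x"
proof -
  have "edge x \<noteq> edge (k, i, q)" using inj_onD[OF inj_edge_of _ x(1) u] x(2) by blast
  then obtain c where "c \<le> ldist (k, i, q) x" "(edge (k, i, q'), edge x) \<in> adj L ^^ c"
    using twin_walk[OF walk_ldist[OF u x(1)]] sibling_leaves_twins[OF u v q] by metis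
  then show ?thesis using ldist_le[OF x(1)] by (meson order_trans)
qed

text \<open>Two omitted leaf edges of one component would have equal distances to every element of \<open>S\<close>.\<close>

lemma one_missing:
  assumes S: "doubly_resolving_set L S"
    and u: "(k, i, q) \<in> V" and v: "(k, i, q') \<in> V" and q: "q div m = q' div m"
    and uS: "edge (k, i, q) \<notin> S" and vS: "edge (k, i, q') \<notin> S"
  shows "q = q'"
proof (rule ccontr)
  assume "q \<noteq> q'"
  then have "edge (k, i, q) \<noteq> edge (k, i, q')" using inj_onD[OF inj_edge_of _ u v] by blast
  moreover have "edge (k, i, q) \<in> verts L" "edge (k, i, q') \<in> verts L"
    unfolding verts_L by (intro imageI u v)+
  ultimately obtain x y where
    xy: "x \<in> S" "y \<in> S" "doubly_resolve L x y (edge (k, i, q)) (edge (k, i, q'))"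
    using S unfolding doubly_resolving_set_def by meson
  have "gdist L (edge (k, i, q)) z = gdist L (edge (k, i, q')) z" if "z \<in> S" for z
  proof -
    obtain c where c: "c \<in> V" "z = edge c" using S \<open>z \<in> S\<close> by (auto simp: doubly_resolving_set_def verts_L)
    then have "c \<noteq> (k, i, q)" "c \<noteq> (k, i, q')" using uS vS that by auto
    then have "ldist (k, i, q) c = ldist (k, i, q') c"
      using twin_ldist_le[OF u v q c(1)] twin_ldist_le[OF v u q[symmetric] c(1)] by simp
    then show ?thesis by (simp add: ldist_def c)
  qed
  then show False using xy by (auto simp: doubly_resolve_def)
qed

text \<open>By \<open>one_missing\<close>, an omitted leaf is determined by its component, of which there are
  \<open>n m\<^bsup>k-3\<^esup>\<close>.\<close>

lemma lower_bound:
  assumes S: "doubly_resolving_set L S"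
  shows "n * m ^ (k - 2) - n * m ^ (k - 3) \<le> card S"
proof -
  let ?A = "{..<n} \<times> {..<m ^ (k - 2)}"
  let ?g = "\<lambda>(i, q). edge (k, i, q)"
  let ?M = "{a \<in> ?A. ?g a \<notin> S}"
  have V: "(k, i, q) \<in> V \<longleftrightarrow> (i, q) \<in> ?A" for i q using k3 by (auto simp: V_iff)
  have inj: "inj_on ?g ?A"
  proof (rule inj_onI)
    fix a b assume ab: "a \<in> ?A" "b \<in> ?A" "?g a = ?g b"
    obtain i q i' q' where [simp]: "a = (i, q)" "b = (i', q')" by (cases a; cases b) auto
    have "(k, i, q) \<in> V" "(k, i', q') \<in> V" using V ab by simp_all
    then show "a = b" using inj_onD[OF inj_edge_of, of "(k, i, q)" "(k, i', q')"] ab(3) by simp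
  qed
  have "finite V" using simple_graph_LSG[OF n3 k3] by (simp add: simple_graph_def)
  then have finS: "finite S"
    using S by (auto simp: doubly_resolving_set_def verts_L intro: finite_subset)
  have "inj_on (\<lambda>(i, q). (i, q div m)) ?M"
  proof (rule inj_onI)
    fix a b assume a: "a \<in> ?M" and b: "b \<in> ?M"
      and eq: "(\<lambda>(i, q). (i, q div m)) a = (\<lambda>(i, q). (i, q div m)) b"
    obtain i q q' where ab: "a = (i, q)" "b = (i, q')" "q div m = q' div m"
      using eq by (cases a; cases b) auto
    have "(k, i, q) \<in> V" "(k, i, q') \<in> V" "edge (k, i, q) \<notin> S" "edge (k, i, q') \<notin> S"
      using a b V unfolding ab by simp_all
    then show "a = b" using one_missing[OF S, of i q q'] ab by simp
  qed
  moreover have "(\<lambda>(i, q). (i, q div m)) ` ?M \<subseteq> {..<n} \<times> {..<m ^ (k - 3)}"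
    using div_less_layer[of _ k] k3 by (auto simp: diff_diff_left numeral_3_eq_3)
  ultimately have "card ?M \<le> card ({..<n} \<times> {..<m ^ (k - 3)})"
    by (rule card_inj_on_le) simp
  then have M: "card ?M \<le> n * m ^ (k - 3)" by (simp add: card_cartesian_product)
  have "?g ` (?A - ?M) \<subseteq> S" by auto
  then have "card (?A - ?M) \<le> card S"
    by (rule card_inj_on_le[OF inj_on_subset[OF inj Diff_subset] _ finS])
  moreover have "card (?A - ?M) = card ?A - card ?M" by (rule card_Diff_subset) auto
  moreover have "card ?A = n * m ^ (k - 2)" by (simp add: card_cartesian_product)
  ultimately show ?thesis using M by linarith
qed

section \<open>A doubly resolving set of leaf edges\<close>

text \<open>The omitted leaf of each component is its first one, whose position is a multiple of \<open>m\<close>.\<close>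

definition basis :: "lsg_vertex set" where
  "basis = {(k, i, q) |i q. i < n \<and> q < m ^ (k - 2) \<and> q mod m \<noteq> 0}"

lemma basis_V: "x \<in> basis \<Longrightarrow> x \<in> V"
  using k3 by (auto simp: basis_def V_iff)

lemma basis_iff: "(k, i, q) \<in> basis \<longleftrightarrow> (k, i, q) \<in> V \<and> q mod m \<noteq> 0"
  using k3 by (auto simp: basis_def V_iff)

lemma card_basis: "card (edge ` basis) = n * m ^ (k - 2) - n * m ^ (k - 3)"
proof -
  let ?B = "{..<n} \<times> {..<m ^ (k - 3)} \<times> {1..<m}"
  let ?g = "\<lambda>(i, j, r). (k, i, j * m + r)"
  have pow: "m ^ (k - 2) = m ^ (k - 3) * m"
    using k3 by (metis Suc_diff_Suc diff_Suc_eq_diff_pred numeral_2_eq_2 numeral_3_eq_3 power_Suc2 Suc_le_eq)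
  have "basis = ?g ` ?B"
  proof
    show "basis \<subseteq> ?g ` ?B"
    proof
      fix x assume "x \<in> basis"
      then obtain i q where x: "x = (k, i, q)" "i < n" "q < m ^ (k - 2)" "q mod m \<noteq> 0"
        by (auto simp: basis_def)
      have "q div m < m ^ (k - 3)" using x(3) pow by (simp add: less_mult_imp_div_less)
      then show "x \<in> ?g ` ?B" using x m2
        by (intro image_eqI[of _ _ "(i, q div m, q mod m)"]) auto
    qed
    show "?g ` ?B \<subseteq> basis"
    proof
      fix x assume "x \<in> ?g ` ?B"
      then obtain i j r where x: "x = (k, i, j * m + r)" "i < n" "j < m ^ (k - 3)" "1 \<le> r" "r < m"
        by auto
      have "j * m + r < Suc j * m" using x by simp
      also have "\<dots> \<le> m ^ (k - 3) * m" using x by (intro mult_right_mono) auto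
      finally show "x \<in> basis" using x pow by (auto simp: basis_def)
    qed
  qed
  moreover have "inj_on ?g ?B"
  proof (rule inj_onI, clarsimp)
    fix j r j' r' assume *: "r < m" "r' < m" "j * m + r = j' * m + r'"
    have "(j * m + r) div m = j" "(j * m + r) mod m = r" using *(1) by simp_all
    moreover have "(j' * m + r') div m = j'" "(j' * m + r') mod m = r'" using *(2) by simp_all
    ultimately show "j = j' \<and> r = r'" using *(3) by metis
  qed
  ultimately have "card basis = n * (m ^ (k - 3) * (m - 1))"
    by (simp add: card_image card_cartesian_product)
  also have "\<dots> = n * m ^ (k - 2) - n * m ^ (k - 3)"
    by (simp add: pow right_diff_distrib')
  also have "card basis = card (edge ` basis)"
    using basis_V inj_edge_of by (intro card_image[symmetric]) (auto intro: inj_on_subset)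
  finally show ?thesis .
qed

text \<open>The second descendant in the last layer is never the first of its component.\<close>

lemma basis_below:
  assumes a: "(l, i, q) \<in> V" "2 \<le> l" "l < k"
  obtains s where "(k, i, s) \<in> basis" "above (l, i, q) (k, i, s)"
proof
  let ?P = "m ^ (k - l)"
  let ?s = "q * ?P + 1"
  have P: "1 < ?P" using one_less_power[of m "k - l"] a m2 by simp
  have "?s < Suc q * ?P" using P by simp
  also have "\<dots> \<le> m ^ (l - 2) * ?P" using a by (intro mult_right_mono) (auto simp: V_iff)
  also have "\<dots> = m ^ (k - 2)" using a by (simp flip: power_add)
  finally have "?s < m ^ (k - 2)" .
  moreover have "m dvd q * ?P" using a by (intro dvd_mult dvd_power) auto
  then have "?s mod m = 1" using m2 by (simp add: mod_Suc)
  ultimately show "(k, i, ?s) \<in> basis" using a by (auto simp: basis_def V_iff)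
  have "?s div ?P = q" using P m2 by (subst div_mult_self3) auto
  then show "above (l, i, q) (k, i, ?s)" using a by (auto simp: above_def)
qed

lemma basis_sibling:
  assumes "(k, i, q) \<in> V" "(k, i, q) \<notin> basis"
  obtains s where "(k, i, s) \<in> basis" "s div m = q div m" "s \<noteq> q"
proof
  have q: "q mod m = 0" "q < m ^ (k - 2)" "i < n" using assms by (auto simp: basis_def V_iff)
  have succ: "(q + 1) div m = q div m" "(q + 1) mod m = 1"
    using q m2 by (auto simp: div_Suc mod_Suc)
  have "m dvd m ^ (k - 2)" "m dvd q" using k3 q by (auto intro: dvd_power)
  then have "q + 1 \<noteq> m ^ (k - 2)" using succ(2) by auto
  then show "(k, i, q + 1) \<in> basis" using q succ by (auto simp: basis_def)
  show "(q + 1) div m = q div m" by (rule succ)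
qed simp

text \<open>Either a chosen leaf edge lies below, at distance \<open>k - l\<close>, or the edge is an omitted leaf edge
  and has a chosen sibling at distance 1.\<close>

lemma basis_near:
  assumes a: "(l, i, q) \<in> V" "2 \<le> l"
  obtains s where "(k, i, s) \<in> basis" "ldist (l, i, q) (k, i, s) < k"
proof (cases "l < k")
  case True
  obtain s where s: "(k, i, s) \<in> basis" "above (l, i, q) (k, i, s)"
    using basis_below[OF a True] .
  then have "ldist (l, i, q) (k, i, s) \<le> k - l" using ldist_above[OF a(1)] basis_V by blast
  then have "ldist (l, i, q) (k, i, s) < k" using a(2) k3 by linarith
  then show thesis using that s by blast
next
  case False
  then have [simp]: "l = k" using a by (simp add: V_iff)
  show thesis
  proof (cases "(k, i, q) \<in> basis")
    case True
    then show thesis using that ldist_self basis_V k3 by fastforce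
  next
    case False
    then obtain s where s: "(k, i, s) \<in> basis" "s div m = q div m" "s \<noteq> q"
      using basis_sibling a by auto
    then show thesis using that ldist_sibling_leaves[of i q s] a basis_V[OF s(1)] k3 by auto
  qed
qed

lemma basis_branch:
  assumes "i < n"
  obtains s where "(k, i, s) \<in> basis"
  using basis_near[of 2 i 0] assms k3 by (auto simp: V_iff)

text \<open>Double resolution by chosen leaf edges, expressed on the names of the edges.\<close>

definition resolved :: "lsg_vertex \<Rightarrow> lsg_vertex \<Rightarrow> bool" where
  "resolved a b \<longleftrightarrow>
     (\<exists>x\<in>basis. \<exists>y\<in>basis. int (ldist a x) - int (ldist a y) \<noteq> int (ldist b x) - int (ldist b y))"

lemma resolved_sym: "resolved a b \<Longrightarrow> resolved b a"
  unfolding resolved_def by metis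

lemma resolvedI:
  "x \<in> basis \<Longrightarrow> y \<in> basis \<Longrightarrow> ldist a x + ldist b y \<noteq> ldist b x + ldist a y \<Longrightarrow> resolved a b"
  unfolding resolved_def by (rule bexI[of _ x], rule bexI[of _ y]) auto

text \<open>A branch touched by the first cycle edge only is compared with one touched by the second; the
  distance \<open>k - 1\<close> is minimal for both edges.\<close>

lemma resolved_cycle_cycle:
  assumes ij: "i < n" "j < n" "i \<noteq> j"
  shows "resolved (1, i, 0) (1, j, 0)"
proof -
  have V: "(1, i, 0) \<in> V" "(1, j, 0) \<in> V" using ij k3 by (auto simp: V_iff)
  have lt: "(i + 1) mod n < n" "(j + 1) mod n < n" using n3 by auto
  have "{i, (i + 1) mod n} \<noteq> {j, (j + 1) mod n}"
    using ij mod_succ_succ_ne[of i] by (auto simp: doubleton_eq_iff)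
  then have "\<not> {i, (i + 1) mod n} \<subseteq> {j, (j + 1) mod n} \<or> \<not> {j, (j + 1) mod n} \<subseteq> {i, (i + 1) mod n}"
    by blast
  moreover have "card {i, (i + 1) mod n} = 2" "card {j, (j + 1) mod n} = 2"
    using mod_succ_ne[OF ij(1)] mod_succ_ne[OF ij(2)] by (simp_all add: card_insert_if)
  ultimately have "\<not> {i, (i + 1) mod n} \<subseteq> {j, (j + 1) mod n}"
    by (metis card_subset_eq finite.emptyI finite.insertI order_refl)
  then obtain p where p: "p \<in> {i, (i + 1) mod n}" "p \<notin> {j, (j + 1) mod n}" by blast
  obtain s t where st: "(k, p, s) \<in> basis" "(k, j, t) \<in> basis"
    using basis_branch p(1) ij lt by (metis insertE singletonD)
  note V' = basis_V[OF st(1)] basis_V[OF st(2)]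
  have "ldist (1, i, 0) (k, p, s) \<le> k - 1" using ldist_above[OF V(1) V'(1)] p by (simp add: above_def)
  moreover have "k - 1 + 1 \<le> ldist (1, j, 0) (k, p, s)"
    using ldist_ge_if_not_above[OF V(2) V'(1)] p by (simp add: above_def)
  moreover have "ldist (1, j, 0) (k, j, t) \<le> k - 1" using ldist_above[OF V(2) V'(2)] by (simp add: above_def)
  moreover have "k - 1 \<le> ldist (1, i, 0) (k, j, t)" by (rule ldist_ge_level[OF V(1) V'(2)])
  ultimately show ?thesis by (intro resolvedI[OF st]) simp
qed

text \<open>The cycle edge touches some branch \<open>p\<close> other than that of the tree edge, and is no further from
  it than from any leaf edge, whereas the tree edge strictly prefers its own branch.\<close>

lemma resolved_cycle_tree:
  assumes j: "j < n" and a: "(l, i, q) \<in> V" "2 \<le> l"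
  shows "resolved (1, j, 0) (l, i, q)"
proof -
  have V: "(1, j, 0) \<in> V" using j k3 by (auto simp: V_iff)
  obtain p where p: "p \<in> {j, (j + 1) mod n}" "p \<noteq> i" "p < n"
    using mod_succ_ne[OF j] j by (metis insertCI mod_less_divisor gr_implies_not0 not_gr0)
  obtain s where s: "(k, p, s) \<in> basis" using basis_branch p by blast
  obtain t where t: "(k, i, t) \<in> basis" "ldist (l, i, q) (k, i, t) < k" using basis_near[OF a] .
  note V' = basis_V[OF s] basis_V[OF t(1)]
  have "ldist (1, j, 0) (k, p, s) \<le> k - 1" using ldist_above[OF V V'(1)] p by (simp add: above_def)
  moreover have "k - 1 \<le> ldist (1, j, 0) (k, i, t)" by (rule ldist_ge_level[OF V V'(2)])
  moreover have "k + l - 2 \<le> ldist (l, i, q) (k, p, s)" using ldist_other_branch_ge[OF a V'(1)] p by simp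
  ultimately show ?thesis using t(2) a by (intro resolvedI[OF s t(1)]) simp
qed

text \<open>Each of the two edges is nearer than \<open>k\<close> to some chosen leaf edge of its own branch, and not to
  any leaf edge of the other branch.\<close>

lemma resolved_branches:
  assumes a: "(l, i, q) \<in> V" "2 \<le> l" and b: "(l', i', q') \<in> V" "2 \<le> l'" and ne: "i \<noteq> i'"
  shows "resolved (l, i, q) (l', i', q')"
proof -
  obtain s where s: "(k, i, s) \<in> basis" "ldist (l, i, q) (k, i, s) < k" using basis_near[OF a] .
  obtain t where t: "(k, i', t) \<in> basis" "ldist (l', i', q') (k, i', t) < k" using basis_near[OF b] .
  have "k + l - 2 \<le> ldist (l, i, q) (k, i', t)" using ldist_other_branch_ge[OF a basis_V[OF t(1)]] ne by simp
  moreover have "k + l' - 2 \<le> ldist (l', i', q') (k, i, s)"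
    using ldist_other_branch_ge[OF b basis_V[OF s(1)]] ne by simp
  ultimately show ?thesis using s(2) t(2) a b by (intro resolvedI[OF s(1) t(1)]) simp
qed

text \<open>If the pair is unresolved, comparison with the next branch forces the distances to every chosen
  leaf edge to differ by exactly \<open>l' - l\<close>. For a leaf edge below the deeper edge, the shallower one
  would then have to be at distance \<open>k - 2 l' + l\<close>, which is less than its minimum \<open>k - l\<close> unless
  the levels agree; and if they agree, both are the ancestor of that leaf edge at this level.\<close>

lemma resolved_same_branch:
  assumes a: "(l, i, q) \<in> V" "2 \<le> l" and b: "(l', i, q') \<in> V" and le: "l \<le> l'"
    and ne: "(l, q) \<noteq> (l', q')"
  shows "resolved (l, i, q) (l', i, q')"
proof (rule ccontr)
  assume nr: "\<not> resolved (l, i, q) (l', i, q')"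
  have lk: "l' \<le> k" "l \<le> k" "2 \<le> l'" using a b le by (auto simp: V_iff)
  have "(i + 1) mod n < n" using n3 by simp
  then obtain t where t: "(k, (i + 1) mod n, t) \<in> basis" using basis_branch by blast
  have shift: "ldist (l, i, q) x + (l' - l) = ldist (l', i, q') x" if "x \<in> basis" for x
  proof -
    have "ldist (l, i, q) x + ldist (l', i, q') (k, (i + 1) mod n, t)
        = ldist (l', i, q') x + ldist (l, i, q) (k, (i + 1) mod n, t)"
      using nr resolvedI[OF that t] by blast
    then show ?thesis
      using ldist_next_branch[OF a basis_V[OF t]] ldist_next_branch[OF b lk(3) basis_V[OF t]] le a(2) by simp
  qed
  \<comment> \<open>A chosen leaf edge counts as being below itself, so \<open>sibling\<close> is left for omitted ones only.\<close>
  consider (below) s where "(k, i, s) \<in> basis" "above (l', i, q') (k, i, s)"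
    | (sibling) s where "l' = k" "(k, i, s) \<in> basis" "s div m = q' div m" "s \<noteq> q'" "(k, i, q') \<notin> basis"
  proof (cases "l' < k")
    case True
    then show thesis using basis_below[OF b lk(3)] below by blast
  next
    case False
    then have "l' = k" using lk by simp
    then show thesis using basis_sibling[of i q'] b below[of q'] sibling lk
      by (cases "(k, i, q') \<in> basis") (auto simp: above_def)
  qed
  then show False
  proof cases
    case (below s)
    note x = basis_V[OF below(1)]
    have 1: "ldist (l', i, q') (k, i, s) \<le> k - l'" using ldist_above[OF b x below(2)] .
    then have "k - l \<le> k - l' - (l' - l)" using shift[OF below(1)] ldist_ge_level[OF a(1) x] by linarith
    then have "l = l'" using le lk by linarith
    moreover have "above (l, i, q) (k, i, s)"
      using ldist_ge_if_not_above[OF a(1) x] shift[OF below(1)] 1 \<open>l = l'\<close> by fastforce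
    ultimately show False using below(2) ne a(2) by (auto simp: above_def)
  next
    case (sibling s)
    note x = basis_V[OF sibling(2)]
    have b': "(k, i, q') \<in> V" using b sibling(1) by simp
    have "ldist (l', i, q') (k, i, s) = 1"
      using ldist_sibling_leaves[OF b' x] sibling by simp
    then have *: "ldist (l, i, q) (k, i, s) + (k - l) = 1" using shift[OF sibling(2)] sibling(1) by simp
    \<comment> \<open>If \<open>l = k\<close>, the other edge is a sibling too, hence chosen, and its own distance 0 breaks the
      constant difference; if \<open>l = k - 1\<close>, it would be at distance 0 from a leaf edge.\<close>
    show False
    proof (cases "l = k")
      case True
      then have "q div m = s div m" using * siblings_if_ldist_1[of i q s] a x by simp
      moreover have "q \<noteq> q'" using ne True sibling by simp
      moreover have "q' mod m = 0" using sibling(5) b' by (simp add: basis_iff)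
      ultimately have "q mod m \<noteq> 0"
        using sibling(3) div_mult_mod_eq[of q m] div_mult_mod_eq[of q' m] by auto
      then have "(k, i, q) \<in> basis" using a True by (simp add: basis_iff)
      with \<open>q \<noteq> q'\<close> show False
        using shift[of "(k, i, q)"] ldist_self[of "(k, i, q)"] ldist_pos[OF b', of "(k, i, q)"] a True sibling(1) le
        by auto
    next
      case False
      then have "ldist (l, i, q) (k, i, s) = 0" using * lk by linarith
      then show False using ldist_pos[OF a(1) x] False by auto
    qed
  qed
qed

lemma resolved_all:
  assumes a: "a \<in> V" and b: "b \<in> V" and "a \<noteq> b"
  shows "resolved a b"
proof -
  obtain l i q where [simp]: "a = (l, i, q)" by (cases a)
  obtain l' i' q' where [simp]: "b = (l', i', q')" by (cases b)
  have q: "q = 0" if "l = 1" using that a by (simp add: V_iff)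
  have q': "q' = 0" if "l' = 1" using that b by (simp add: V_iff)
  have i: "i < n" "i' < n" using a b by (auto simp: V_iff)
  consider "l = 1" "l' = 1" | "l = 1" "l' \<ge> 2" | "l' = 1" "l \<ge> 2" | "l \<ge> 2" "l' \<ge> 2"
    using a b by (fastforce simp: V_iff)
  then show ?thesis
  proof cases
    case 1
    then show ?thesis using resolved_cycle_cycle[of i i'] i q q' assms(3) by auto
  next
    case 2
    then show ?thesis using resolved_cycle_tree[of i l' i' q'] i q b by auto
  next
    case 3
    then show ?thesis using resolved_cycle_tree[of i' l i q, THEN resolved_sym] i q' a by auto
  next
    case 4
    consider "i \<noteq> i'" | "i = i'" "l \<le> l'" | "i = i'" "l' \<le> l" by linarith
    then show ?thesis
    proof cases
      case 1
      then show ?thesis using resolved_branches 4 a b by simp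
    next
      case 2
      then show ?thesis using resolved_same_branch[of l i q l' q'] 4 a b assms(3) by auto
    next
      case 3
      then show ?thesis
        using resolved_same_branch[of l' i' q' l q, THEN resolved_sym] 4 a b assms(3) by auto
    qed
  qed
qed

lemma basis_doubly_resolving: "doubly_resolving_set L (edge ` basis)"
  unfolding doubly_resolving_set_def
proof (intro conjI ballI impI)
  show "edge ` basis \<subseteq> verts L" using basis_V by (auto simp: verts_L)
  fix u v assume "u \<in> verts L" "v \<in> verts L" "u \<noteq> v"
  then obtain a b where ab: "a \<in> V" "b \<in> V" "u = edge a" "v = edge b"
    unfolding verts_L by blast
  then have "resolved a b" using resolved_all \<open>u \<noteq> v\<close> by blast
  then show "\<exists>x\<in>edge ` basis. \<exists>y\<in>edge ` basis. doubly_resolve L x y u v"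
    unfolding ab(3,4) by (auto simp: resolved_def doubly_resolve_def ldist_def)
qed

end

theorem theorem3p4:
  fixes n m k :: nat
  assumes "n \<ge> 3" and "k \<ge> 3" and "m \<ge> 2"
  shows "(\<exists>S. doubly_resolving_set (line_graph (LSG n m k)) S \<and>
              card S = n * m ^ (k - 2) - n * m ^ (k - 3)) \<and>
         (\<forall>S. doubly_resolving_set (line_graph (LSG n m k)) S \<longrightarrow>
              n * m ^ (k - 2) - n * m ^ (k - 3) \<le> card S)"
proof -
  interpret layer_sun n m k using assms by unfold_locales
  show ?thesis using basis_doubly_resolving card_basis lower_bound by blast
qed

end
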